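(* Let $P,Q$ be finite sets of propositional variables, $M=(W,\prec,\Vdash)$ and $M'=(W',\prec',\Vdash')$ Kripke models, $w\in W$, $w'\in W'$ and $n\in\omega$. The following are equivalent: (1) $\mathrm{Th}_n^{(P,Q)}(w)\subseteq\mathrm{Th}_n^{(P,Q)}(w')$; (2) there exists a layered $(P,Q)$-bisimulation $Z$ between $M$ and $M'$ with $(w,n,w')\in Z$; (3) there exists a downward closed layered $(P,Q)$-bisimulation $Z$ between $M$ and $M'$ with $(w,n,w')\in Z$.
   Context: Formulas are built from propositional variables, $\bot$, $\to$, $\Box$. Modal depth: $d(p)=d(\bot)=0$, $d(\varphi\to\psi)=\max\{d(\varphi),d(\psi)\}$, $d(\Box\varphi)=d(\varphi)+1$. Positive/negative variable sets: $v^+(p)=\{p\}$, $v^-(p)=\emptyset$; $v^\pm(\bot)=\emptyset$; $v^+(\psi\to\theta)=v^-(\psi)\cup v^+(\theta)$, $v^-(\psi\to\theta)=v^+(\psi)\cup v^-(\theta)$; $v^\pm(\Box\psi)=v^\pm(\psi)$. A $(P,Q)$-formula is a formula $\varphi$ with $v^+(\varphi)\subseteq P$, $v^-(\varphi)\subseteq Q$. For each $n$, $F_n^{(P,Q)}$ is a fixed finite set of $(P,Q)$-formulas of depth $\le n$ such that every $(P,Q)$-formula of depth $\le n$ is $\mathbf{K}$-provably equivalent to a member of it. A Kripke model $(W,\prec,\Vdash)$: $W$ nonempty, $\prec$ a binary relation on $W$, $\Vdash$ satisfaction with usual Boolean clauses and $x\Vdash\Box\varphi$ iff $y\Vdash\varphi$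 for all $y\succ x$. $\mathrm{Th}_n^{(P,Q)}(w)=\{\varphi\in F_n^{(P,Q)}: w\Vdash\varphi\}$. A relation $Z\subseteq W\times\omega\times W'$ is a layered $(P,Q)$-bisimulation between $M$ and $M'$ if: (i) whenever $(w,n,w')\in Z$: for each $p\in P$, $w\Vdash p$ implies $w'\Vdash' p$, and for each $q\in Q$, $w\nVdash q$ implies $w'\nVdash' q$; (ii) if $(w,n+1,w')\in Z$ and $w\prec x$, there is $x'\in W'$ with $w'\prec' x'$ and $(x,n,x')\in Z$; (iii) if $(w,n+1,w')\in Z$ and $w'\prec' x'$, there is $x\in W$ with $w\prec x$ and $(x,n,x')\in Z$. $Z$ is downward closed if $(w,n,w')\in Z$ implies $(w,m,w')\in Z$ for all $m\le n$. *)

theory Defs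
  imports Main
begin

datatype 'v fm = Var 'v | Fls | Imp "'v fm" "'v fm" | Box "'v fm"

primrec depth :: "'v fm \<Rightarrow> nat" where
  "depth (Var p) = 0"
| "depth Fls = 0"
| "depth (Imp \<phi> \<psi>) = max (depth \<phi>) (depth \<psi>)"
| "depth (Box \<phi>) = depth \<phi> + 1"

fun vpos :: "'v fm \<Rightarrow> 'v set" and vneg :: "'v fm \<Rightarrow> 'v set" where
  "vpos (Var p) = {p}"
| "vpos Fls = {}"
| "vpos (Imp \<phi> \<psi>) = vneg \<phi> \<union> vpos \<psi>"
| "vpos (Box \<phi>) = vpos \<phi>"
| "vneg (Var p) = {}"
| "vneg Fls = {}"
| "vneg (Imp \<phi> \<psi>) = vpos \<phi> \<union> vneg \<psi>"
| "vneg (Box \<phi>) = vneg \<phi>"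

definition PQ_formula :: "'v set \<Rightarrow> 'v set \<Rightarrow> 'v fm \<Rightarrow> bool" where
  "PQ_formula P Q \<phi> \<longleftrightarrow> vpos \<phi> \<subseteq> P \<and> vneg \<phi> \<subseteq> Q"

abbreviation Neg :: "'v fm \<Rightarrow> 'v fm" where
  "Neg \<phi> \<equiv> Imp \<phi> Fls"

abbreviation Conj :: "'v fm \<Rightarrow> 'v fm \<Rightarrow> 'v fm" where
  "Conj \<phi> \<psi> \<equiv> Neg (Imp \<phi> (Neg \<psi>))"

abbreviation Iff :: "'v fm \<Rightarrow> 'v fm \<Rightarrow> 'v fm" where
  "Iff \<phi> \<psi> \<equiv> Conj (Imp \<phi> \<psi>) (Imp \<psi> \<phi>)"

text \<open>Truth-functional evaluation: boxed formulas are treated as atoms, whose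
  values (like those of the variables) are read off \<open>v\<close>.\<close>

primrec teval :: "('v fm \<Rightarrow> bool) \<Rightarrow> 'v fm \<Rightarrow> bool" where
  "teval v (Var p) = v (Var p)"
| "teval v Fls = False"
| "teval v (Imp \<phi> \<psi>) = (teval v \<phi> \<longrightarrow> teval v \<psi>)"
| "teval v (Box \<phi>) = v (Box \<phi>)"

definition tautology :: "'v fm \<Rightarrow> bool" where
  "tautology \<phi> \<longleftrightarrow> (\<forall>v. teval v \<phi>)"

inductive K_prov :: "'v fm \<Rightarrow> bool" where
  Taut: "tautology \<phi> \<Longrightarrow> K_prov \<phi>"
| AxK: "K_prov (Imp (Box (Imp \<phi> \<psi>)) (Imp (Box \<phi>) (Box \<psi>)))"
| MP: "K_prov (Imp \<phi> \<psi>) \<Longrightarrow> K_prov \<phi> \<Longrightarrow> K_prov \<psi>"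
| Nec: "K_prov \<phi> \<Longrightarrow> K_prov (Box \<phi>)"

definition K_equiv :: "'v fm \<Rightarrow> 'v fm \<Rightarrow> bool" where
  "K_equiv \<phi> \<psi> \<longleftrightarrow> K_prov (Iff \<phi> \<psi>)"

definition representative_set :: "'v set \<Rightarrow> 'v set \<Rightarrow> nat \<Rightarrow> 'v fm set \<Rightarrow> bool" where
  "representative_set P Q n S \<longleftrightarrow>
     finite S \<and>
     (\<forall>\<phi>\<in>S. PQ_formula P Q \<phi> \<and> depth \<phi> \<le> n) \<and>
     (\<forall>\<phi>. PQ_formula P Q \<phi> \<and> depth \<phi> \<le> n \<longrightarrow> (\<exists>\<psi>\<in>S. K_equiv \<phi> \<psi>))"

text \<open>A choice of the sets \<open>F\<^sub>n\<close> for all pairs of finite sets of variables and all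
  depths; \<open>representative_family_exists\<close> below shows that such choices exist.\<close>

definition representative_family :: "('v set \<Rightarrow> 'v set \<Rightarrow> nat \<Rightarrow> 'v fm set) \<Rightarrow> bool" where
  "representative_family F \<longleftrightarrow>
     (\<forall>P Q n. finite P \<longrightarrow> finite Q \<longrightarrow> representative_set P Q n (F P Q n))"

record ('w, 'v) model =
  worlds :: "'w set"
  acc :: "('w \<times> 'w) set"
  forces :: "'w \<Rightarrow> 'v fm \<Rightarrow> bool"

definition kripke_model :: "('w, 'v) model \<Rightarrow> bool" where
  "kripke_model M \<longleftrightarrow>
     worlds M \<noteq> {} \<and>
     acc M \<subseteq> worlds M \<times> worlds M \<and>
     (\<forall>x\<in>worlds M.
        \<not> forces M x Fls \<and>
        (\<forall>\<phi> \<psi>. forces M x (Imp \<phi> \<psi>) \<longleftrightarrow> (forces M x \<phi> \<longrightarrow> forces M x \<psi>)) \<and>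
        (\<forall>\<phi>. forces M x (Box \<phi>) \<longleftrightarrow> (\<forall>y. (x, y) \<in> acc M \<longrightarrow> forces M y \<phi>)))"

definition Th :: "('v set \<Rightarrow> 'v set \<Rightarrow> nat \<Rightarrow> 'v fm set) \<Rightarrow> 'v set \<Rightarrow> 'v set \<Rightarrow> nat
    \<Rightarrow> ('w, 'v) model \<Rightarrow> 'w \<Rightarrow> 'v fm set" where
  "Th F P Q n M w = {\<phi> \<in> F P Q n. forces M w \<phi>}"

definition layered_bisim :: "'v set \<Rightarrow> 'v set \<Rightarrow> ('a, 'v) model \<Rightarrow> ('b, 'v) model
    \<Rightarrow> ('a \<times> nat \<times> 'b) set \<Rightarrow> bool" where
  "layered_bisim P Q M M' Z \<longleftrightarrow>
     Z \<subseteq> worlds M \<times> UNIV \<times> worlds M' \<and>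
     (\<forall>w n w'. (w, n, w') \<in> Z \<longrightarrow>
        (\<forall>p\<in>P. forces M w (Var p) \<longrightarrow> forces M' w' (Var p)) \<and>
        (\<forall>q\<in>Q. \<not> forces M w (Var q) \<longrightarrow> \<not> forces M' w' (Var q))) \<and>
     (\<forall>w n w' x. (w, n + 1, w') \<in> Z \<and> (w, x) \<in> acc M \<longrightarrow>
        (\<exists>x'\<in>worlds M'. (w', x') \<in> acc M' \<and> (x, n, x') \<in> Z)) \<and>
     (\<forall>w n w' x'. (w, n + 1, w') \<in> Z \<and> (w', x') \<in> acc M' \<longrightarrow>
        (\<exists>x\<in>worlds M. (w, x) \<in> acc M \<and> (x, n, x') \<in> Z))"

definition downward_closed :: "('a \<times> nat \<times> 'b) set \<Rightarrow> bool" where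
  "downward_closed Z \<longleftrightarrow> (\<forall>w n w'. (w, n, w') \<in> Z \<longrightarrow> (\<forall>m\<le>n. (w, m, w') \<in> Z))"


lemma K_equiv_imps: "K_equiv \<phi> \<psi> \<longleftrightarrow> K_prov (Imp \<phi> \<psi>) \<and> K_prov (Imp \<psi> \<phi>)"
proof
  assume "K_equiv \<phi> \<psi>"
  then have eq: "K_prov (Iff \<phi> \<psi>)" by (simp add: K_equiv_def)
  have "K_prov (Imp (Iff \<phi> \<psi>) (Imp \<phi> \<psi>))" "K_prov (Imp (Iff \<phi> \<psi>) (Imp \<psi> \<phi>))"
    by (rule K_prov.Taut, simp add: tautology_def)+
  with eq show "K_prov (Imp \<phi> \<psi>) \<and> K_prov (Imp \<psi> \<phi>)"
    using K_prov.MP by blast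
next
  assume imps: "K_prov (Imp \<phi> \<psi>) \<and> K_prov (Imp \<psi> \<phi>)"
  have "K_prov (Imp (Imp \<phi> \<psi>) (Imp (Imp \<psi> \<phi>) (Iff \<phi> \<psi>)))"
    by (rule K_prov.Taut) (simp add: tautology_def)
  with imps show "K_equiv \<phi> \<psi>"
    unfolding K_equiv_def using K_prov.MP by blast
qed

lemma K_prov_trans:
  assumes "K_prov (Imp \<phi> \<psi>)" "K_prov (Imp \<psi> \<chi>)" shows "K_prov (Imp \<phi> \<chi>)"
proof -
  have "K_prov (Imp (Imp \<phi> \<psi>) (Imp (Imp \<psi> \<chi>) (Imp \<phi> \<chi>)))"
    by (rule K_prov.Taut) (simp add: tautology_def)
  with assms show ?thesis using K_prov.MP by blast
qed

lemma K_prov_Imp_mono: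
  assumes "K_prov (Imp \<phi>' \<phi>)" "K_prov (Imp \<psi> \<psi>')"
  shows "K_prov (Imp (Imp \<phi> \<psi>) (Imp \<phi>' \<psi>'))"
proof -
  have "K_prov (Imp (Imp \<phi>' \<phi>) (Imp (Imp \<psi> \<psi>') (Imp (Imp \<phi> \<psi>) (Imp \<phi>' \<psi>'))))"
    by (rule K_prov.Taut) (simp add: tautology_def)
  with assms show ?thesis using K_prov.MP by blast
qed

lemma K_equiv_refl: "K_equiv \<phi> \<phi>"
  unfolding K_equiv_def by (rule K_prov.Taut) (simp add: tautology_def)

lemma K_equiv_sym: "K_equiv \<phi> \<psi> \<Longrightarrow> K_equiv \<psi> \<phi>"
  by (simp add: K_equiv_imps)

lemma K_equiv_trans: "K_equiv \<phi> \<psi> \<Longrightarrow> K_equiv \<psi> \<chi> \<Longrightarrow> K_equiv \<phi> \<chi>"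
  unfolding K_equiv_imps by (blast intro: K_prov_trans)

lemma K_equiv_Imp: "K_equiv \<phi> \<phi>' \<Longrightarrow> K_equiv \<psi> \<psi>' \<Longrightarrow> K_equiv (Imp \<phi> \<psi>) (Imp \<phi>' \<psi>')"
  unfolding K_equiv_imps by (blast intro: K_prov_Imp_mono)

lemma K_equiv_Box: "K_equiv \<phi> \<psi> \<Longrightarrow> K_equiv (Box \<phi>) (Box \<psi>)"
  unfolding K_equiv_imps by (blast intro: K_prov.MP[OF K_prov.AxK] K_prov.Nec)

inductive_set bool_closure :: "'v fm set \<Rightarrow> 'v fm set" for A where
  "\<phi> \<in> A \<Longrightarrow> \<phi> \<in> bool_closure A"
| "Fls \<in> bool_closure A"
| "\<phi> \<in> bool_closure A \<Longrightarrow> \<psi> \<in> bool_closure A \<Longrightarrow> Imp \<phi> \<psi> \<in> bool_closure A"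

lemma bool_closure_finite_mod_K:
  fixes A :: "'v fm set"
  assumes fin: "finite A" and atoms: "A \<subseteq> range Var \<union> range Box"
  shows "\<exists>G. finite G \<and> (\<forall>\<phi>\<in>bool_closure A. \<exists>\<psi>\<in>G. K_equiv \<phi> \<psi>)"
proof -
  define f :: "'v fm \<Rightarrow> 'v fm set set" where "f \<phi> = {S \<in> Pow A. teval (\<lambda>x. x \<in> S) \<phi>}" for \<phi>
  have restrict: "teval v \<phi> \<longleftrightarrow> teval (\<lambda>x. x \<in> {a \<in> A. v a}) \<phi>" if "\<phi> \<in> bool_closure A" for v \<phi>
    using that by induction (use atoms in auto)
  have eqv: "K_equiv \<phi> \<psi>"
    if "\<phi> \<in> bool_closure A" "\<psi> \<in> bool_closure A" "f \<phi> = f \<psi>" for \<phi> \<psi>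
  proof -
    have "teval v \<phi> \<longleftrightarrow> teval v \<psi>" for v
    proof -
      have "{a \<in> A. v a} \<in> f \<phi> \<longleftrightarrow> {a \<in> A. v a} \<in> f \<psi>" using that by simp
      then show ?thesis
        using restrict[OF that(1), of v] restrict[OF that(2), of v] by (auto simp: f_def)
    qed
    then show ?thesis
      unfolding K_equiv_def by (intro K_prov.Taut) (simp add: tautology_def)
  qed
  let ?B = "bool_closure A"
  have "f ` ?B \<subseteq> Pow (Pow A)" by (auto simp: f_def)
  then have "finite (f ` ?B)" using fin by (meson finite_Pow_iff finite_subset)
  moreover have "\<exists>\<psi>\<in>inv_into ?B f ` f ` ?B. K_equiv \<phi> \<psi>" if "\<phi> \<in> ?B" for \<phi>
    using that eqv[OF that, of "inv_into ?B f (f \<phi>)"]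
    by (auto simp: f_inv_into_f inv_into_into)
  ultimately show ?thesis by (intro exI[of _ "inv_into ?B f ` f ` ?B"]) blast
qed

lemma depth_finite_mod_K:
  fixes V :: "'v set"
  assumes fin: "finite V"
  shows "\<exists>G. finite G \<and> (\<forall>\<phi>. vpos \<phi> \<union> vneg \<phi> \<subseteq> V \<and> depth \<phi> \<le> n \<longrightarrow> (\<exists>\<psi>\<in>G. K_equiv \<phi> \<psi>))"
proof (induction n)
  case 0
  have "\<phi> \<in> bool_closure (Var ` V)" if "vpos \<phi> \<union> vneg \<phi> \<subseteq> V" "depth \<phi> \<le> 0" for \<phi>
    using that by (induction \<phi>) (auto intro: bool_closure.intros)
  moreover obtain G where "finite G" "\<forall>\<phi>\<in>bool_closure (Var ` V). \<exists>\<psi>\<in>G. K_equiv \<phi> \<psi>"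
    using bool_closure_finite_mod_K[of "Var ` V"] fin by auto
  ultimately show ?case by blast
next
  case (Suc n)
  then obtain H where H: "finite H"
    "\<And>\<phi>. vpos \<phi> \<union> vneg \<phi> \<subseteq> V \<Longrightarrow> depth \<phi> \<le> n \<Longrightarrow> \<exists>\<psi>\<in>H. K_equiv \<phi> \<psi>" by blast
  let ?A = "Var ` V \<union> Box ` H"
  have *: "\<exists>\<psi>\<in>bool_closure ?A. K_equiv \<phi> \<psi>"
    if "vpos \<phi> \<union> vneg \<phi> \<subseteq> V" "depth \<phi> \<le> Suc n" for \<phi>
    using that
  proof (induction \<phi>)
    case (Var p)
    then show ?case by (auto intro!: bexI[of _ "Var p"] K_equiv_refl bool_closure.intros)
  next
    case Fls
    then show ?case by (auto intro!: bexI[of _ Fls] K_equiv_refl bool_closure.intros)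
  next
    case (Imp \<phi> \<psi>)
    then obtain \<phi>' \<psi>' where "\<phi>' \<in> bool_closure ?A" "K_equiv \<phi> \<phi>'"
      "\<psi>' \<in> bool_closure ?A" "K_equiv \<psi> \<psi>'" by auto
    then show ?case using K_equiv_Imp bool_closure.intros(3) by blast
  next
    case (Box \<phi>)
    then obtain \<psi> where "\<psi> \<in> H" "K_equiv \<phi> \<psi>" using H(2)[of \<phi>] by auto
    then show ?case
      using K_equiv_Box by (intro bexI[of _ "Box \<psi>"]) (auto intro: bool_closure.intros)
  qed
  obtain G where G: "finite G" "\<forall>\<phi>\<in>bool_closure ?A. \<exists>\<psi>\<in>G. K_equiv \<phi> \<psi>"
    using bool_closure_finite_mod_K[of ?A] fin H(1) by auto
  have "\<exists>\<psi>\<in>G. K_equiv \<phi> \<psi>" if "vpos \<phi> \<union> vneg \<phi> \<subseteq> V" "depth \<phi> \<le> Suc n" for \<phi>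
    using *[OF that] G(2) K_equiv_trans by blast
  with G(1) show ?case by blast
qed

lemma representative_set_exists:
  fixes P Q :: "'v set"
  assumes "finite P" "finite Q"
  shows "\<exists>S. representative_set P Q n S"
proof -
  define C where "C = {\<phi>. PQ_formula P Q \<phi> \<and> depth \<phi> \<le> n}"
  obtain G where G: "finite G"
    "\<forall>\<phi>. vpos \<phi> \<union> vneg \<phi> \<subseteq> P \<union> Q \<and> depth \<phi> \<le> n \<longrightarrow> (\<exists>\<psi>\<in>G. K_equiv \<phi> \<psi>)"
    using depth_finite_mod_K[OF finite_UnI[OF assms], of n] by (elim exE conjE)
  define H where "H = {\<psi> \<in> G. \<exists>\<phi>. \<phi> \<in> C \<and> K_equiv \<phi> \<psi>}"
  have "\<forall>\<psi>\<in>H. \<exists>\<phi>. \<phi> \<in> C \<and> K_equiv \<phi> \<psi>" by (simp add: H_def)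
  then obtain r where r: "\<forall>\<psi>\<in>H. r \<psi> \<in> C \<and> K_equiv (r \<psi>) \<psi>"
    by (elim bchoice[THEN exE])
  have cover: "\<exists>\<psi>\<in>r ` H. K_equiv \<phi> \<psi>" if C: "\<phi> \<in> C" for \<phi>
  proof -
    have "vpos \<phi> \<union> vneg \<phi> \<subseteq> P \<union> Q \<and> depth \<phi> \<le> n"
      using C by (auto simp: C_def PQ_formula_def)
    then obtain \<psi> where psi: "\<psi> \<in> G" "K_equiv \<phi> \<psi>" using G(2) by blast
    then have H: "\<psi> \<in> H" using C by (auto simp: H_def)
    then have "K_equiv (r \<psi>) \<psi>" using r by simp
    then have "K_equiv \<phi> (r \<psi>)" by (rule K_equiv_trans[OF psi(2) K_equiv_sym])
    with H show ?thesis by (intro bexI[of _ "r \<psi>"] imageI)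
  qed
  have "finite (r ` H)" using G(1) by (simp add: H_def)
  moreover have "r ` H \<subseteq> C" using r by auto
  ultimately have "representative_set P Q n (r ` H)"
    unfolding representative_set_def using cover unfolding C_def by (intro conjI) auto
  then show ?thesis by (rule exI)
qed

lemma representative_family_exists: "\<exists>F. representative_family F"
proof
  show "representative_family (\<lambda>P Q n. SOME S. representative_set P Q n S)"
    unfolding representative_family_def
    by (intro allI impI someI_ex[OF representative_set_exists])
qed

end

theory Submission
  imports Defs
begin

text \<open>
  Preservation of \<open>(P,Q)\<close>-formulas along a layered bisimulation is proved by induction on the
  formula, together with the reflection of \<open>(Q,P)\<close>-formulas, since implication swaps the polarities.
  Conversely, relate \<open>w\<close> and \<open>w'\<close> at level \<open>n\<close> whenever every \<open>(P,Q)\<close>-formula of depth at most \<open>n\<close>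
  true at \<open>w\<close> is true at \<open>w'\<close>. As there are finitely many such formulas up to equivalence, if a
  successor \<open>x\<close> of \<open>w\<close> had no match then \<open>\<diamond>\<And>{\<phi>. x \<tturnstile> \<phi>}\<close> would be true at \<open>w\<close> but not at \<open>w'\<close>;
  if a successor \<open>x'\<close> of \<open>w'\<close> had no match then \<open>\<box>\<Or>{\<phi>. \<not> x' \<tturnstile> \<phi>}\<close> would be.
\<close>

lemma forces_simps:
  assumes "kripke_model M" "x \<in> worlds M"
  shows "\<not> forces M x Fls"
    and "forces M x (Imp \<phi> \<psi>) \<longleftrightarrow> (forces M x \<phi> \<longrightarrow> forces M x \<psi>)"
    and "forces M x (Box \<phi>) \<longleftrightarrow> (\<forall>y. (x, y) \<in> acc M \<longrightarrow> forces M y \<phi>)"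
  using assms unfolding kripke_model_def by blast+

lemma acc_worlds:
  assumes "kripke_model M" "(x, y) \<in> acc M"
  shows "x \<in> worlds M" "y \<in> worlds M"
  using assms unfolding kripke_model_def by blast+

text \<open>\<open>teval\<close> reads boxed formulas off the valuation as if they were atoms, so
  evaluating with \<open>forces M x\<close> itself reproduces satisfaction. This makes tautologies
  true at every world.\<close>

lemma teval_forces:
  assumes "kripke_model M" "x \<in> worlds M"
  shows "teval (forces M x) \<phi> \<longleftrightarrow> forces M x \<phi>"
  by (induction \<phi>) (simp_all add: forces_simps[OF assms])

lemma K_sound:
  assumes "K_prov \<phi>" "kripke_model M" "x \<in> worlds M"
  shows "forces M x \<phi>"
  using assms(1,3)
proof (induction arbitrary: x)
  case (Taut \<phi>)
  then show ?case using teval_forces[OF assms(2)] by (auto simp: tautology_def)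
next
  case (AxK \<phi> \<psi>)
  then show ?case using forces_simps[OF assms(2)] acc_worlds[OF assms(2)] by metis
next
  case (MP \<phi> \<psi>)
  then show ?case using forces_simps(2)[OF assms(2)] by blast
next
  case (Nec \<phi>)
  then show ?case using forces_simps(3)[OF assms(2)] acc_worlds[OF assms(2)] by blast
qed

lemma K_equiv_forces:
  assumes "K_equiv \<phi> \<psi>" "kripke_model M" "x \<in> worlds M"
  shows "forces M x \<phi> \<longleftrightarrow> forces M x \<psi>"
  using assms(1) K_sound[OF _ assms(2,3)] forces_simps(2)[OF assms(2,3)]
  unfolding K_equiv_imps by blast

primrec conj_list :: "'v fm list \<Rightarrow> 'v fm" where
  "conj_list [] = Neg Fls"
| "conj_list (\<phi> # \<Phi>) = Conj \<phi> (conj_list \<Phi>)"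

primrec disj_list :: "'v fm list \<Rightarrow> 'v fm" where
  "disj_list [] = Fls"
| "disj_list (\<phi> # \<Phi>) = Imp (Neg \<phi>) (disj_list \<Phi>)"

lemma forces_conj_list:
  assumes "kripke_model M" "x \<in> worlds M"
  shows "forces M x (conj_list \<Phi>) \<longleftrightarrow> (\<forall>\<phi>\<in>set \<Phi>. forces M x \<phi>)"
  by (induction \<Phi>) (simp_all add: forces_simps[OF assms])

lemma forces_disj_list:
  assumes "kripke_model M" "x \<in> worlds M"
  shows "forces M x (disj_list \<Phi>) \<longleftrightarrow> (\<exists>\<phi>\<in>set \<Phi>. forces M x \<phi>)"
  by (induction \<Phi>) (auto simp: forces_simps[OF assms])

text \<open>In \<open>Conj\<close>, both conjuncts sit under exactly two antecedents, so their
  polarities are unchanged.\<close>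

lemma PQ_depth_conj_list:
  assumes "\<forall>\<phi>\<in>set \<Phi>. PQ_formula P Q \<phi> \<and> depth \<phi> \<le> n"
  shows "PQ_formula P Q (conj_list \<Phi>) \<and> depth (conj_list \<Phi>) \<le> n"
  using assms by (induction \<Phi>) (auto simp: PQ_formula_def)

lemma PQ_depth_disj_list:
  assumes "\<forall>\<phi>\<in>set \<Phi>. PQ_formula P Q \<phi> \<and> depth \<phi> \<le> n"
  shows "PQ_formula P Q (disj_list \<Phi>) \<and> depth (disj_list \<Phi>) \<le> n"
  using assms by (induction \<Phi>) (auto simp: PQ_formula_def)

text \<open>Quantifying over all formulas rather than a chosen finite set makes downward closure
  immediate. For finite \<open>P\<close> and \<open>Q\<close> this is the greatest layered
  bisimulation between two Kripke models.\<close>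

definition transfer_rel :: "'v set \<Rightarrow> 'v set \<Rightarrow> ('a, 'v) model \<Rightarrow> ('b, 'v) model
    \<Rightarrow> ('a \<times> nat \<times> 'b) set" where
  "transfer_rel P Q M M' = {(w, n, w'). w \<in> worlds M \<and> w' \<in> worlds M' \<and>
     (\<forall>\<phi>. PQ_formula P Q \<phi> \<and> depth \<phi> \<le> n \<longrightarrow> forces M w \<phi> \<longrightarrow> forces M' w' \<phi>)}"

lemma transfer_relD:
  assumes "(w, n, w') \<in> transfer_rel P Q M M'" "PQ_formula P Q \<phi>" "depth \<phi> \<le> n" "forces M w \<phi>"
  shows "forces M' w' \<phi>"
  using assms unfolding transfer_rel_def by blast

lemma transfer_rel_worlds:
  assumes "(w, n, w') \<in> transfer_rel P Q M M'"
  shows "w \<in> worlds M" "w' \<in> worlds M'"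
  using assms unfolding transfer_rel_def by blast+

lemma downward_closed_transfer_rel: "downward_closed (transfer_rel P Q M M')"
  unfolding downward_closed_def transfer_rel_def using le_trans by blast

text \<open>By soundness, a formula and its representative agree at every world, so testing finitely
  many formulas suffices.\<close>

lemma transfer_rel_iff_representatives:
  assumes S: "representative_set P Q n S" and M: "kripke_model M" and M': "kripke_model M'"
    and w: "w \<in> worlds M" and w': "w' \<in> worlds M'"
  shows "(w, n, w') \<in> transfer_rel P Q M M' \<longleftrightarrow> (\<forall>\<phi>\<in>S. forces M w \<phi> \<longrightarrow> forces M' w' \<phi>)"
proof
  assume "(w, n, w') \<in> transfer_rel P Q M M'"
  then show "\<forall>\<phi>\<in>S. forces M w \<phi> \<longrightarrow> forces M' w' \<phi>"
    using S unfolding representative_set_def transfer_rel_def by blast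
next
  assume sub: "\<forall>\<phi>\<in>S. forces M w \<phi> \<longrightarrow> forces M' w' \<phi>"
  have "forces M' w' \<phi>" if \<phi>: "PQ_formula P Q \<phi>" "depth \<phi> \<le> n" "forces M w \<phi>" for \<phi>
  proof -
    obtain \<psi> where "\<psi> \<in> S" "K_equiv \<phi> \<psi>"
      using S \<phi>(1,2) unfolding representative_set_def by blast
    then show ?thesis
      using sub \<phi>(3) K_equiv_forces[OF _ M w] K_equiv_forces[OF _ M' w'] by blast
  qed
  then show "(w, n, w') \<in> transfer_rel P Q M M'"
    unfolding transfer_rel_def using w w' by blast
qed

lemma transfer_rel_forth:
  assumes fin: "finite P" "finite Q" and M: "kripke_model M" and M': "kripke_model M'"
    and rel: "(w, Suc n, w') \<in> transfer_rel P Q M M'" and wx: "(w, x) \<in> acc M"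
  shows "\<exists>x'\<in>worlds M'. (w', x') \<in> acc M' \<and> (x, n, x') \<in> transfer_rel P Q M M'"
proof -
  note w = transfer_rel_worlds[OF rel] and x = acc_worlds(2)[OF M wx]
  obtain S where S: "representative_set P Q n S"
    using representative_set_exists[OF fin] by blast
  then obtain \<Phi> where \<Phi>: "set \<Phi> = {\<phi> \<in> S. forces M x \<phi>}"
    using finite_list[of "{\<phi> \<in> S. forces M x \<phi>}"] by (auto simp: representative_set_def)
  then have PQ: "PQ_formula P Q (conj_list \<Phi>) \<and> depth (conj_list \<Phi>) \<le> n"
    using S by (intro PQ_depth_conj_list) (auto simp: representative_set_def)
  \<comment> \<open>This is the diamond of the conjunction: the two negations restore the
    polarities, and the box uses up the extra level \<open>Suc n\<close>.\<close>
  let ?\<chi> = "Neg (Box (Neg (conj_list \<Phi>)))"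
  have "forces M x (conj_list \<Phi>)"
    using \<Phi> by (simp add: forces_conj_list[OF M x])
  then have "forces M w ?\<chi>"
    using wx x by (auto simp: forces_simps[OF M w(1)] forces_simps[OF M x])
  moreover have "PQ_formula P Q ?\<chi>" "depth ?\<chi> \<le> Suc n"
    using PQ by (auto simp: PQ_formula_def)
  ultimately have "forces M' w' ?\<chi>"
    using transfer_relD[OF rel] by blast
  then obtain x' where x': "(w', x') \<in> acc M'" "\<not> forces M' x' (Neg (conj_list \<Phi>))"
    by (auto simp: forces_simps[OF M' w(2)])
  note wx' = acc_worlds(2)[OF M' x'(1)]
  have "\<forall>\<phi>\<in>S. forces M x \<phi> \<longrightarrow> forces M' x' \<phi>"
    using x'(2) \<Phi> by (auto simp: forces_simps[OF M' wx'] forces_conj_list[OF M' wx'])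
  then show ?thesis
    using transfer_rel_iff_representatives[OF S M M' x wx'] x'(1) wx' by blast
qed

text \<open>Exchanging the models would reverse the direction of transfer, so the argument is
  dualised instead: a box over the disjunction of the representatives false at \<open>x'\<close>
  fails at \<open>w'\<close>, hence at \<open>w\<close>, and a successor refuting it is the
  match.\<close>

lemma transfer_rel_back:
  assumes fin: "finite P" "finite Q" and M: "kripke_model M" and M': "kripke_model M'"
    and rel: "(w, Suc n, w') \<in> transfer_rel P Q M M'" and wx': "(w', x') \<in> acc M'"
  shows "\<exists>x\<in>worlds M. (w, x) \<in> acc M \<and> (x, n, x') \<in> transfer_rel P Q M M'"
proof -
  note w = transfer_rel_worlds[OF rel] and x' = acc_worlds(2)[OF M' wx']
  obtain S where S: "representative_set P Q n S"
    using representative_set_exists[OF fin] by blast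
  then obtain \<Phi> where \<Phi>: "set \<Phi> = {\<phi> \<in> S. \<not> forces M' x' \<phi>}"
    using finite_list[of "{\<phi> \<in> S. \<not> forces M' x' \<phi>}"] by (auto simp: representative_set_def)
  then have "PQ_formula P Q (disj_list \<Phi>) \<and> depth (disj_list \<Phi>) \<le> n"
    using S by (intro PQ_depth_disj_list) (auto simp: representative_set_def)
  then have "PQ_formula P Q (Box (disj_list \<Phi>))" "depth (Box (disj_list \<Phi>)) \<le> Suc n"
    by (auto simp: PQ_formula_def)
  moreover have "\<not> forces M' x' (disj_list \<Phi>)"
    using \<Phi> by (simp add: forces_disj_list[OF M' x'])
  then have "\<not> forces M' w' (Box (disj_list \<Phi>))"
    using wx' by (auto simp: forces_simps[OF M' w(2)])
  ultimately have "\<not> forces M w (Box (disj_list \<Phi>))"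
    using transfer_relD[OF rel] by blast
  then obtain x where x: "(w, x) \<in> acc M" "\<not> forces M x (disj_list \<Phi>)"
    by (auto simp: forces_simps[OF M w(1)])
  note wx = acc_worlds(2)[OF M x(1)]
  have "\<forall>\<phi>\<in>S. forces M x \<phi> \<longrightarrow> forces M' x' \<phi>"
    using x(2) \<Phi> by (auto simp: forces_disj_list[OF M wx])
  then show ?thesis
    using transfer_rel_iff_representatives[OF S M M' wx x'] x(1) wx by blast
qed

lemma layered_bisim_transfer_rel:
  assumes fin: "finite P" "finite Q" and M: "kripke_model M" and M': "kripke_model M'"
  shows "layered_bisim P Q M M' (transfer_rel P Q M M')"
proof -
  have "forces M' w' (Var p)"
    if "(w, n, w') \<in> transfer_rel P Q M M'" "p \<in> P" "forces M w (Var p)" for w n w' p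
    using transfer_relD[OF that(1), of "Var p"] that(2,3) by (simp add: PQ_formula_def)
  moreover have "\<not> forces M' w' (Var q)"
    if "(w, n, w') \<in> transfer_rel P Q M M'" "q \<in> Q" "\<not> forces M w (Var q)" for w n w' q
    \<comment> \<open>The variable \<open>q\<close> occurs only negatively in its negation, which is
      therefore a \<open>(P,Q)\<close>-formula.\<close>
    using transfer_relD[OF that(1), of "Neg (Var q)"] that(2,3) transfer_rel_worlds[OF that(1)]
    by (simp add: PQ_formula_def forces_simps[OF M] forces_simps[OF M'])
  moreover have "transfer_rel P Q M M' \<subseteq> worlds M \<times> UNIV \<times> worlds M'"
    by (auto simp: transfer_rel_def)
  ultimately show ?thesis
    unfolding layered_bisim_def
    using transfer_rel_forth[OF fin M M'] transfer_rel_back[OF fin M M'] by simp blast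
qed

lemma layered_bisim_preserves:
  assumes Z: "layered_bisim P Q M M' Z" and M: "kripke_model M" and M': "kripke_model M'"
    and "(w, n, w') \<in> Z" "depth \<phi> \<le> n"
  shows "(PQ_formula P Q \<phi> \<longrightarrow> forces M w \<phi> \<longrightarrow> forces M' w' \<phi>) \<and>
         (PQ_formula Q P \<phi> \<longrightarrow> forces M' w' \<phi> \<longrightarrow> forces M w \<phi>)"
  using assms(4,5)
proof (induction \<phi> arbitrary: w n w')
  case (Var p)
  then show ?case using Z unfolding layered_bisim_def PQ_formula_def by fastforce
next
  case Fls
  then have "w \<in> worlds M" "w' \<in> worlds M'"
    using Z unfolding layered_bisim_def by blast+
  then show ?case using forces_simps(1)[OF M] forces_simps(1)[OF M'] by blast
next
  case (Imp \<phi> \<psi>)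
  then have "w \<in> worlds M" "w' \<in> worlds M'"
    using Z unfolding layered_bisim_def by blast+
  then show ?case
    using Imp.IH[OF Imp.prems(1)] Imp.prems(2)
    by (auto simp: PQ_formula_def forces_simps(2)[OF M] forces_simps(2)[OF M'])
next
  case (Box \<phi>)
  \<comment> \<open>A boxed formula has positive depth, so \<open>n\<close> is a successor and both
    zigzag clauses apply. Preservation then uses the back clause \<open>bwd\<close>, reflection the
    forth clause \<open>fwd\<close>.\<close>
  then obtain m where m: "n = m + 1" "depth \<phi> \<le> m"
    by (cases n) auto
  have w: "w \<in> worlds M" "w' \<in> worlds M'"
    using Z Box.prems(1) unfolding layered_bisim_def by blast+
  have fwd: "\<exists>x'. (w', x') \<in> acc M' \<and> (x, m, x') \<in> Z" if "(w, x) \<in> acc M" for x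
    using Z Box.prems(1) that unfolding layered_bisim_def m(1) by blast
  have bwd: "\<exists>x. (w, x) \<in> acc M \<and> (x, m, x') \<in> Z" if "(w', x') \<in> acc M'" for x'
    using Z Box.prems(1) that unfolding layered_bisim_def m(1) by blast
  have "forces M' x' \<phi>"
    if "PQ_formula P Q \<phi>" "\<forall>x. (w, x) \<in> acc M \<longrightarrow> forces M x \<phi>" "(w', x') \<in> acc M'" for x'
    using bwd[OF that(3)] Box.IH[OF _ m(2)] that(1,2) by blast
  moreover have "forces M x \<phi>"
    if "PQ_formula Q P \<phi>" "\<forall>x'. (w', x') \<in> acc M' \<longrightarrow> forces M' x' \<phi>" "(w, x) \<in> acc M" for x
    using fwd[OF that(3)] Box.IH[OF _ m(2)] that(1,2) by blast
  ultimately show ?case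
    by (simp add: forces_simps(3)[OF M w(1)] forces_simps(3)[OF M' w(2)] PQ_formula_def)
qed

text \<open>Maximality of \<open>transfer_rel\<close>: membership in any layered bisimulation at all
  already forces the inclusion of theories.\<close>

lemma layered_bisim_subset_transfer_rel:
  assumes "layered_bisim P Q M M' Z" "kripke_model M" "kripke_model M'"
  shows "Z \<subseteq> transfer_rel P Q M M'"
proof -
  have "Z \<subseteq> worlds M \<times> UNIV \<times> worlds M'"
    using assms(1) by (simp add: layered_bisim_def)
  then show ?thesis
    using layered_bisim_preserves[OF assms] unfolding transfer_rel_def by blast
qed

theorem theorem3p6:
  fixes F :: "'v set \<Rightarrow> 'v set \<Rightarrow> nat \<Rightarrow> 'v fm set"
    and P Q :: "'v set"
    and M :: "('a, 'v) model" and M' :: "('b, 'v) model"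
    and w :: 'a and w' :: 'b and n :: nat
  assumes "representative_family F"
    and "finite P" and "finite Q"
    and "kripke_model M" and "kripke_model M'"
    and "w \<in> worlds M" and "w' \<in> worlds M'"
  shows "(Th F P Q n M w \<subseteq> Th F P Q n M' w' \<longleftrightarrow>
            (\<exists>Z. layered_bisim P Q M M' Z \<and> (w, n, w') \<in> Z)) \<and>
         ((\<exists>Z. layered_bisim P Q M M' Z \<and> (w, n, w') \<in> Z) \<longleftrightarrow>
            (\<exists>Z. layered_bisim P Q M M' Z \<and> downward_closed Z \<and> (w, n, w') \<in> Z))"
proof -
  have "representative_set P Q n (F P Q n)"
    using assms(1-3) by (simp add: representative_family_def)
  from transfer_rel_iff_representatives[OF this assms(4-7)]
  have "Th F P Q n M w \<subseteq> Th F P Q n M' w' \<longleftrightarrow> (w, n, w') \<in> transfer_rel P Q M M'"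
    by (auto simp: Th_def)
  \<comment> \<open>\<open>transfer_rel\<close> is a downward closed layered bisimulation containing
    every other one, so it serves as the witness in both existential statements.\<close>
  moreover note layered_bisim_transfer_rel[OF assms(2-5)]
    downward_closed_transfer_rel[of P Q M M']
    layered_bisim_subset_transfer_rel[OF _ assms(4,5), of P Q]
  ultimately show ?thesis by blast
qed

end
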